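(* Let $m,\ell$ be coprime integers with $\ell>m$ and $\ell\neq-m$, let $c_1,c_2$ be nonzero real numbers with $(mc_1)^2=(\ell c_2)^2$, and let $f(t)=c_1e^{itm}+c_2e^{it\ell}$, $t\in\mathbb{R}$. Then the elements of the group $G(\ell,m)$ map the set of local singular points of the curve $f$ onto itself.
   Context: Write $f=\phi+i\psi$ with $\phi,\psi$ real-valued. The local singular points of the curve $x=\phi(t)$, $y=\psi(t)$ are those points $f(t)$ of the plane where $\dot\phi(t)=\dot\psi(t)=0$. $G(\ell,m)$ is the finite group of rotations of the complex plane whose elements are the multiplications by $g_k=e^{2ik\pi/(\ell-m)}$, $0\le k\le\ell-m-1$. *)

theory Defs
  imports "HOL-Analysis.Analysis" "HOL-Algebra.Group"
begin

definition trig_curve :: "int \<Rightarrow> int \<Rightarrow> real \<Rightarrow> real \<Rightarrow> real \<Rightarrow> complex" where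
  "trig_curve l m c1 c2 t =
     of_real c1 * exp (\<i> * of_real t * of_int m) + of_real c2 * exp (\<i> * of_real t * of_int l)"

text \<open>The vanishing of the derivatives includes their existence, so a parameter at which a
  component fails to be differentiable never counts as singular.\<close>

definition local_singular_points :: "(real \<Rightarrow> complex) \<Rightarrow> complex set" where
  "local_singular_points f = {f t | t.
     ((\<lambda>s. Re (f s)) has_real_derivative 0) (at t) \<and>
     ((\<lambda>s. Im (f s)) has_real_derivative 0) (at t)}"

definition rotation :: "int \<Rightarrow> int \<Rightarrow> int \<Rightarrow> complex \<Rightarrow> complex" where
  "rotation l m k = (\<lambda>z. exp (2 * \<i> * of_int k * of_real pi / of_int (l - m)) * z)"

definition rotation_group :: "int \<Rightarrow> int \<Rightarrow> (complex \<Rightarrow> complex) monoid" where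
  "rotation_group l m =
     \<lparr>carrier = rotation l m ` {0..l - m - 1}, mult = (\<circ>), one = id\<rparr>"

lemma rotation_mod:
  assumes "m < l"
  shows "rotation l m (k mod (l - m)) = rotation l m k"
proof -
  let ?n = "l - m"
  have n: "(of_int ?n :: complex) \<noteq> 0"
    using assms by (simp del: of_int_diff)
  have "(of_int k :: complex) = of_int (k mod ?n) + of_int ?n * of_int (k div ?n)"
    by (metis add.commute mult_div_mod_eq of_int_add of_int_mult)
  then have "2 * \<i> * of_int k * of_real pi / of_int ?n =
      2 * \<i> * of_int (k mod ?n) * of_real pi / of_int ?n + 2 * of_int (k div ?n) * of_real pi * \<i>"
    using n by (simp add: field_simps del: of_int_diff)
  moreover have "exp (2 * of_int (k div ?n) * of_real pi * \<i>) = (1 :: complex)"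
    using exp_integer_2pi[OF Ints_of_int[of "k div ?n"]] by (simp add: mult_ac)
  ultimately show ?thesis
    by (simp add: rotation_def exp_add del: of_int_diff)
qed

lemma rotation_comp: "rotation l m j \<circ> rotation l m k = rotation l m (j + k)"
  by (simp add: rotation_def fun_eq_iff exp_add ring_distribs add_divide_distrib
      flip: mult.assoc del: of_int_diff)

lemma rotation_0: "rotation l m 0 = id"
  by (simp add: rotation_def fun_eq_iff)

lemma rotation_in_group:
  assumes "m < l"
  shows "rotation l m k \<in> carrier (rotation_group l m)"
proof -
  have "k mod (l - m) \<in> {0..l - m - 1}"
    using assms by simp
  then show ?thesis
    unfolding rotation_group_def by (metis assms imageI partial_object.select_convs(1) rotation_mod)
qed

lemma group_rotation_group:
  assumes "m < l"
  shows "group (rotation_group l m)"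
proof (rule groupI)
  fix x y assume "x \<in> carrier (rotation_group l m)" "y \<in> carrier (rotation_group l m)"
  then obtain j k where "x = rotation l m j" "y = rotation l m k"
    by (auto simp: rotation_group_def)
  then show "x \<otimes>\<^bsub>rotation_group l m\<^esub> y \<in> carrier (rotation_group l m)"
    using rotation_in_group[OF assms, of "j + k"] rotation_comp[of l m j k]
    by (simp add: rotation_group_def)
next
  show "\<one>\<^bsub>rotation_group l m\<^esub> \<in> carrier (rotation_group l m)"
    using rotation_in_group[OF assms, of 0] by (simp add: rotation_group_def rotation_0)
next
  fix x assume "x \<in> carrier (rotation_group l m)"
  then obtain k where "x = rotation l m k"
    by (auto simp: rotation_group_def)
  then have "rotation l m (- k) \<otimes>\<^bsub>rotation_group l m\<^esub> x = \<one>\<^bsub>rotation_group l m\<^esub>"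
    using rotation_comp[of l m "- k" k] by (simp add: rotation_group_def rotation_0)
  then show "\<exists>y\<in>carrier (rotation_group l m). y \<otimes>\<^bsub>rotation_group l m\<^esub> x = \<one>\<^bsub>rotation_group l m\<^esub>"
    using rotation_in_group[OF assms] by blast
qed (auto simp: rotation_group_def comp_assoc)

end

theory Submission
  imports Defs
begin

text \<open>Put \<open>n = l - m\<close>. A time shift by \<open>2\<pi>j/n\<close> multiplies the first summand of the curve by
  \<open>exp (2\<pi>ijm/n)\<close> and the second by \<open>exp (2\<pi>ijl/n)\<close>. Since \<open>l = m + n\<close>, these two factors agree,
  so the shifted curve is the original one rotated by \<open>2\<pi>jm/n\<close> (\<open>trig_curve_shift\<close>). As \<open>m\<close> is
  coprime to \<open>n\<close>, it is a unit modulo \<open>n\<close>, so every element of the rotation group arises in this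
  way (\<open>rotation_as_shift\<close>). Singularity is not affected by shifting the parameter or by applying
  a linear map to the plane, so rotations carry singular points to singular points
  (\<open>mult_local_singular_points_subset\<close>). Surjectivity follows by applying this inclusion to the
  inverse rotation.\<close>

lemma local_singular_points_alt:
  "local_singular_points f = {f t | t. (f has_vector_derivative 0) (at t)}"
  by (simp add: local_singular_points_def has_vector_derivative_complex_iff)

text \<open>The derivative at \<open>t + \<tau>\<close> of a curve satisfying the functional equation is \<open>c\<close> times its
  derivative at \<open>t\<close>.\<close>

lemma mult_local_singular_points_subset:
  assumes shift: "\<And>t. f (t + \<tau>) = c * f t"
  shows "(\<lambda>z. c * z) ` local_singular_points f \<subseteq> local_singular_points f"
proof
  fix w assume "w \<in> (\<lambda>z. c * z) ` local_singular_points f"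
  then obtain t where w: "w = c * f t" and D: "(f has_vector_derivative 0) (at t)"
    unfolding local_singular_points_alt by blast
  have "f s = c * f (s - \<tau>)" for s
    using shift[of "s - \<tau>"] by simp
  then have f: "f = (\<lambda>s. c * f (s - \<tau>))"
    by (rule ext)
  have "((\<lambda>s. s - \<tau>) has_vector_derivative 1) (at (t + \<tau>))"
    by (auto intro!: derivative_eq_intros)
  moreover have "(f has_vector_derivative 0) (at (t + \<tau> - \<tau>))"
    using D by simp
  ultimately have "((f \<circ> (\<lambda>s. s - \<tau>)) has_vector_derivative 1 *\<^sub>R 0) (at (t + \<tau>))"
    by (rule vector_diff_chain_at)
  then have "((\<lambda>s. c * f (s - \<tau>)) has_vector_derivative c * 0) (at (t + \<tau>))"
    by (intro has_vector_derivative_mult_right) (simp add: o_def)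
  then have "(f has_vector_derivative 0) (at (t + \<tau>))"
    using f by simp
  moreover have "w = f (t + \<tau>)"
    using shift w by simp
  ultimately show "w \<in> local_singular_points f"
    unfolding local_singular_points_alt by blast
qed

lemma trig_curve_shift:
  assumes "l \<noteq> m"
  shows "trig_curve l m c1 c2 (t + 2 * pi * of_int j / of_int (l - m)) =
    rotation l m (j * m) (trig_curve l m c1 c2 t)"
proof -
  define n where "n = l - m"
  define \<theta> :: complex where "\<theta> = 2 * \<i> * of_int (j * m) * of_real pi / of_int n"
  define t' where "t' = t + 2 * pi * of_int j / of_int n"
  have n: "(of_int n :: complex) \<noteq> 0"
    using assms by (simp add: n_def del: of_int_diff)
  have l: "l = m + n"
    by (simp add: n_def)
  have m_summand: "\<i> * of_real t' * of_int m = \<theta> + \<i> * of_real t * of_int m"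
    using n by (simp add: t'_def \<theta>_def field_simps)
  have l_summand: "\<i> * of_real t' * of_int l =
      \<theta> + \<i> * of_real t * of_int l + 2 * of_int j * of_real pi * \<i>"
    using n by (simp add: t'_def \<theta>_def l field_simps)
  have period: "exp (2 * of_int j * of_real pi * \<i>) = (1 :: complex)"
    using exp_integer_2pi[OF Ints_of_int[of j]] by (simp add: mult_ac)
  have "trig_curve l m c1 c2 t' = exp \<theta> * trig_curve l m c1 c2 t"
    unfolding trig_curve_def m_summand l_summand exp_add period by (simp add: algebra_simps)
  then show ?thesis
    unfolding t'_def \<theta>_def n_def rotation_def .
qed

text \<open>Multiplication by \<open>m\<close> permutes the residues modulo \<open>l - m\<close>.\<close>

lemma rotation_as_shift:
  assumes "coprime m l" and "m < l"
  obtains j where "rotation l m k = rotation l m (j * m)"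
proof -
  have "gcd m (l - m) = 1"
    using assms(1) by (metis coprime_imp_gcd_eq_1 gcd.commute gcd_diff1)
  then obtain u v where uv: "u * m + v * (l - m) = 1"
    using bezout_int by metis
  have "k = k * (u * m + v * (l - m))"
    unfolding uv by simp
  also have "\<dots> = k * u * m + k * v * (l - m)"
    by (simp add: algebra_simps)
  finally have "k mod (l - m) = (k * u * m) mod (l - m)"
    by (metis mod_mult_self1)
  then have "rotation l m k = rotation l m (k * u * m)"
    using rotation_mod[OF assms(2)] by metis
  then show thesis ..
qed

lemma rotation_local_singular_points_subset:
  assumes "coprime m l" and "m < l"
  shows "rotation l m k ` local_singular_points (trig_curve l m c1 c2)
    \<subseteq> local_singular_points (trig_curve l m c1 c2)"
proof -
  obtain j where j: "rotation l m k = rotation l m (j * m)"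
    using rotation_as_shift[OF assms] .
  have "l \<noteq> m"
    using assms(2) by simp
  from trig_curve_shift[OF this, of c1 c2 _ j]
  have "rotation l m (j * m) ` local_singular_points (trig_curve l m c1 c2)
      \<subseteq> local_singular_points (trig_curve l m c1 c2)"
    unfolding rotation_def by (rule mult_local_singular_points_subset)
  then show ?thesis
    by (simp only: j)
qed

theorem theorem7p8:
  fixes m l :: int and c1 c2 :: real
  assumes "coprime m l" and "l > m" and "l \<noteq> - m"
    and "c1 \<noteq> 0" and "c2 \<noteq> 0"
    and "(of_int m * c1)\<^sup>2 = (of_int l * c2)\<^sup>2"
  shows "\<forall>g \<in> carrier (rotation_group l m).
    g ` local_singular_points (trig_curve l m c1 c2) = local_singular_points (trig_curve l m c1 c2)"
proof
  let ?S = "local_singular_points (trig_curve l m c1 c2)"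
  fix g assume "g \<in> carrier (rotation_group l m)"
  then obtain k where g: "g = rotation l m k"
    by (auto simp: rotation_group_def)
  have subset: "rotation l m i ` ?S \<subseteq> ?S" for i
    using rotation_local_singular_points_subset assms(1,2) .
  have "?S = rotation l m k ` rotation l m (- k) ` ?S"
    by (simp add: image_comp rotation_comp rotation_0)
  also have "\<dots> \<subseteq> rotation l m k ` ?S"
    by (intro image_mono subset)
  finally show "g ` ?S = ?S"
    unfolding g using subset by blast
qed

end
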